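(* Let $A$ be a finite commutative unitary ring (with $0_A\neq 1_A$). Then $\ell_{A[X]}<+\infty$ if and only if $A\cong \mathbb{Z}/2\mathbb{Z}$ or $A\cong\mathbb{Z}/3\mathbb{Z}$. Moreover, $\ell_{(\mathbb{Z}/2\mathbb{Z})[X]}=\ell_{(\mathbb{Z}/3\mathbb{Z})[X]}=4$, and for $k\in\{2,3\}$, \[\mathrm{Irr}((\mathbb{Z}/k\mathbb{Z})[X])=\{\pm(\overline{1},\overline{1},\overline{1}),\ (\overline{0},P(X),\overline{0},-P(X)),\ (P(X),\overline{0},-P(X),\overline{0})\ ;\ P\in(\mathbb{Z}/k\mathbb{Z})[X]\setminus\{\pm\overline{1}\}\}.\]
   Context: All rings are commutative, unitary and nonzero. For a ring $B$ and $a_1,\dots,a_n\in B$, set $M_n(a_1,\dots,a_n)=\begin{pmatrix}a_n&-1\\1&0\end{pmatrix}\cdots\begin{pmatrix}a_1&-1\\1&0\end{pmatrix}$. An $n$-tuple $(a_1,\dots,a_n)\in B^n$ ($n\ge1$) is a $\lambda$-quiddity over $B$ if $M_n(a_1,\dots,a_n)=\epsilon\,\mathrm{Id}$ for some $\epsilon\in\{\pm1_B\}$. For $(a_1,\dots,a_n)\in B^n$, $(b_1,\dots,b_m)\in B^m$ define $(a_1,\dots,a_n)\oplus(b_1,\dots,b_m)=(a_1+b_m,a_2,\dots,a_{n-1},a_n+b_1,b_2,\dots,b_{m-1})$. Two $n$-tuples are equivalent ($\sim$) if one is obtained from the other or from its reversal $(a_n,\dots,a_1)$ by a cyclic rotation.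 A $\lambda$-quiddity $(c_1,\dots,c_n)$ with $n\ge3$ is reducible if there exist a $\lambda$-quiddity $(b_1,\dots,b_l)$ over $B$ and $(a_1,\dots,a_m)\in B^m$ with $m\ge3$, $l\ge3$ and $(c_1,\dots,c_n)\sim(a_1,\dots,a_m)\oplus(b_1,\dots,b_l)$; a $\lambda$-quiddity is irreducible if it is not reducible (the 2-tuple $(0,0)$ is never considered irreducible). $\mathrm{Irr}(B)$ is the set of irreducible $\lambda$-quiddities over $B$. $\ell_B$ is the maximal size of irreducible $\lambda$-quiddities over $B$ if their sizes are bounded, and $\ell_B=+\infty$ otherwise. $\overline{a}$ denotes the class of the integer $a$ modulo $k$. *)

theory Defs
  imports
    "HOL-Analysis.Cartesian_Space"
    "HOL-Computational_Algebra.Polynomial"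
    "HOL-Library.Extended_Nat"
    "HOL-Library.Numeral_Type"
begin

text \<open>
  Rings are types of class \<^class>\<open>comm_ring_1\<close> (commutative, unitary, \<open>0 \<noteq> 1\<close>), and
  tuples \<open>(a\<^sub>1, \<dots>, a\<^sub>n)\<close> are lists of length \<open>n\<close>.  The rings \<open>\<int>/2\<int>\<close> and \<open>\<int>/3\<int>\<close> are the numeral
  types \<^typ>\<open>2\<close> and \<^typ>\<open>3\<close>, whose arithmetic is integer arithmetic modulo 2 and 3.
\<close>

definition ring_isomorphism :: "('a::comm_ring_1 \<Rightarrow> 'b::comm_ring_1) \<Rightarrow> bool" where
  "ring_isomorphism f \<longleftrightarrow>
     bij f \<and> f 1 = 1 \<and> (\<forall>x y. f (x + y) = f x + f y) \<and> (\<forall>x y. f (x * y) = f x * f y)"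

definition elementary_matrix :: "'b::comm_ring_1 \<Rightarrow> 'b^2^2" where
  "elementary_matrix a = vector [vector [a, -1], vector [1, 0]]"

text \<open>The factor of the first entry is the rightmost one.\<close>

primrec continuant_matrix :: "'b::comm_ring_1 list \<Rightarrow> 'b^2^2" where
  "continuant_matrix [] = mat 1"
| "continuant_matrix (a # as) = continuant_matrix as ** elementary_matrix a"

definition lambda_quiddity :: "'b::comm_ring_1 list \<Rightarrow> bool" where
  "lambda_quiddity c \<longleftrightarrow> c \<noteq> [] \<and> (\<exists>\<epsilon> \<in> {1, -1}. continuant_matrix c = mat \<epsilon>)"

text \<open>
  \<open>(a\<^sub>1 + b\<^sub>m, a\<^sub>2, \<dots>, a\<^bsub>n-1\<^esub>, a\<^sub>n + b\<^sub>1, b\<^sub>2, \<dots>, b\<^bsub>m-1\<^esub>)\<close>; only meaningful if both lists have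
  length at least 2.
\<close>

definition tuple_sum :: "'b::comm_ring_1 list \<Rightarrow> 'b list \<Rightarrow> 'b list" where
  "tuple_sum a b =
     [hd a + last b] @ butlast (tl a) @ [last a + hd b] @ butlast (tl b)"

definition tuple_equiv :: "'b list \<Rightarrow> 'b list \<Rightarrow> bool" where
  "tuple_equiv c d \<longleftrightarrow> (\<exists>k. d = rotate k c \<or> d = rotate k (rev c))"

definition reducible :: "'b::comm_ring_1 list \<Rightarrow> bool" where
  "reducible c \<longleftrightarrow> lambda_quiddity c \<and> length c \<ge> 3 \<and>
     (\<exists>a b. length a \<ge> 3 \<and> length b \<ge> 3 \<and> lambda_quiddity b \<and> tuple_equiv c (tuple_sum a b))"

definition Irr :: "'b::comm_ring_1 list set" where
  "Irr = {c. lambda_quiddity c \<and> \<not> reducible c \<and> c \<noteq> [0, 0]}"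

text \<open>The ring \<open>B\<close> is passed as the type argument \<open>TYPE('b)\<close>.\<close>

definition ell :: "'b::comm_ring_1 itself \<Rightarrow> enat" where
  "ell _ = (if \<exists>N. \<forall>c \<in> (Irr :: 'b list set). length c \<le> N
            then enat (Max (length ` (Irr :: 'b list set))) else \<infinity>)"

end

theory Submission
  imports Defs
begin

text \<open>
  Solving \<open>v\<^bsub>t+1\<^esub> + v\<^bsub>t-1\<^esub> = c\<^sub>t v\<^sub>t\<close> turns a \<open>\<lambda>\<close>-quiddity into a closed walk of vectors of \<open>B \<times> B\<close>
  whose consecutive determinants are 1, and reducing it means finding a chord, that is, two
  non-adjacent vectors with determinant \<open>\<plusminus>1\<close>.  Large irreducible quiddities are long chordless
  cycles.  They run along the path \<open>p\<^sub>i = (U\<^bsub>i+1\<^esub>, U\<^sub>i)\<close> of Chebyshev-like polynomials, for which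
  \<open>det (p\<^sub>i, p\<^sub>j) = U\<^bsub>j-i\<^esub>\<close> has degree \<open>j - i - 1\<close>, and come back along a disjoint copy of it.
  If \<open>A[X]\<close> has a unit \<open>u \<noteq> \<plusminus>1\<close>, the copy consists of multiples of the \<open>p\<^sub>i\<close> by \<open>u\<close> and \<open>-u\<^sup>-\<^sup>1\<close>.
  If \<open>A\<close> has an idempotent \<open>f \<noteq> 0, 1\<close>, the walk goes back and forth along the path in both
  components \<open>f\<close> and \<open>1 - f\<close>, with a delay of two steps between them.
  A finite ring with an element \<open>a \<notin> {0, 1, -1}\<close> falls under one of these cases: some power of \<open>a\<close>
  is idempotent, and if it is 0 then \<open>A\<close> contains some \<open>e \<noteq> 0\<close> with \<open>e\<^sup>2 = 0\<close>, so \<open>1 + e X\<close> is a unit.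
  If instead \<open>A = {0, 1, -1}\<close>, a degree argument shows that a quiddity over \<open>A[X]\<close> has an entry
  in \<open>{0, 1, -1}\<close>, where it can be cut unless its length is at most 4.
\<close>

section \<open>Matrices and closed walks\<close>

lemma elementary_matrix_nth [simp]:
  "elementary_matrix a $ 1 $ 1 = a" "elementary_matrix a $ 1 $ 2 = -1"
  "elementary_matrix a $ 2 $ 1 = 1" "elementary_matrix a $ 2 $ 2 = 0"
  by (simp_all add: elementary_matrix_def)

lemma matrix_mult_2_nth:
  fixes A B :: "'b::comm_ring_1^2^2"
  shows "(A ** B) $ i $ j = A $ i $ 1 * B $ 1 $ j + A $ i $ 2 * B $ 2 $ j"
  by (simp add: matrix_matrix_mult_def sum_2)

lemma mat_2_nth [simp]:
  "(mat a :: 'b::comm_ring_1^2^2) $ 1 $ 1 = a" "(mat a :: 'b^2^2) $ 1 $ 2 = 0"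
  "(mat a :: 'b^2^2) $ 2 $ 1 = 0" "(mat a :: 'b^2^2) $ 2 $ 2 = a"
  by (simp_all add: mat_def)

lemma matrix_2_eq_iff:
  fixes A B :: "'b^2^2"
  shows "A = B \<longleftrightarrow> A $ 1 $ 1 = B $ 1 $ 1 \<and> A $ 1 $ 2 = B $ 1 $ 2
                \<and> A $ 2 $ 1 = B $ 2 $ 1 \<and> A $ 2 $ 2 = B $ 2 $ 2"
  by (auto simp: vec_eq_iff forall_2)

lemma continuant_matrix_append:
  "continuant_matrix (xs @ ys) = continuant_matrix ys ** continuant_matrix xs"
  by (induction xs) (simp_all add: matrix_mul_assoc)

text \<open>Each elementary matrix E satisfies E^T = D E D with D = diag(1, -1), so reversing a
  tuple transposes its matrix up to conjugation by D. In particular the (1,1) entry does not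
  change.\<close>

lemma continuant_matrix_rev_nth:
  "continuant_matrix (rev xs) $ 1 $ 1 = continuant_matrix xs $ 1 $ 1 \<and>
   continuant_matrix (rev xs) $ 1 $ 2 = - continuant_matrix xs $ 2 $ 1 \<and>
   continuant_matrix (rev xs) $ 2 $ 1 = - continuant_matrix xs $ 1 $ 2 \<and>
   continuant_matrix (rev xs) $ 2 $ 2 = continuant_matrix xs $ 2 $ 2"
proof (induction xs)
  case Nil
  then show ?case by simp
next
  case (Cons a xs)
  then show ?case
    by (simp add: continuant_matrix_append matrix_mult_2_nth algebra_simps)
qed

text \<open>The (2,2) entry of E(y) S E(x) is minus the (1,1) entry of S. This yields an obstruction
  to reducibility, because the interior of the second summand survives unaltered in a sum of
  tuples.\<close>

lemma lambda_quiddity_interior: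
  assumes "lambda_quiddity (x # s @ [y])"
  shows "continuant_matrix s $ 1 $ 1 \<in> {1, -1}"
proof -
  obtain \<epsilon> :: 'a where e: "\<epsilon> \<in> {1, -1}" and M: "continuant_matrix (x # s @ [y]) = mat \<epsilon>"
    using assms unfolding lambda_quiddity_def by blast
  define S where "S = continuant_matrix s"
  have "(elementary_matrix y ** S) ** elementary_matrix x = mat \<epsilon>"
    using M by (simp add: continuant_matrix_append S_def)
  then have "- (S $ 1 $ 1) = \<epsilon>"
    unfolding matrix_2_eq_iff by (simp add: matrix_mult_2_nth)
  with e show ?thesis unfolding S_def by (auto simp: minus_equation_iff)
qed

lemma length_tuple_sum:
  assumes "length a \<ge> 3" "length b \<ge> 3"
  shows "length (tuple_sum a b) + 2 = length a + length b"
  using assms by (simp add: tuple_sum_def)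

lemma drop_tuple_sum:
  assumes "length a \<ge> 3"
  shows "drop (length a) (tuple_sum a b) = butlast (tl b)"
proof -
  have "drop (length a)
      ([hd a + last b] @ butlast (tl a) @ [last a + hd b] @ butlast (tl b)) = butlast (tl b)"
    using assms by (simp only: append_assoc[symmetric] drop_append) simp
  then show ?thesis by (simp only: tuple_sum_def)
qed

section \<open>Determinants of plane vectors and closed walks\<close>

definition det2 :: "'b::comm_ring_1 \<times> 'b \<Rightarrow> 'b \<times> 'b \<Rightarrow> 'b" where
  "det2 v w = fst v * snd w - snd v * fst w"

lemma det2_commute: "det2 w v = - det2 v w"
  by (simp add: det2_def)

text \<open>Cramer's rule in the basis \<open>w\<close>, \<open>v\<close>.\<close>

lemma det2_coords:
  assumes "det2 v w = 1" "fst z = a * fst w + b * fst v" "snd z = a * snd w + b * snd v"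
  shows "det2 v z = a" "det2 z w = b"
proof -
  have "det2 v z = a * det2 v w" "det2 z w = b * det2 v w"
    using assms(2,3) by (simp_all add: det2_def algebra_simps)
  then show "det2 v z = a" "det2 z w = b"
    using assms(1) by simp_all
qed

text \<open>The Pluecker relation among three vectors of the plane. It identifies the determinants
  at distance two with the entries of the tuple behind a walk.\<close>

lemma three_term_recurrence:
  assumes "det2 p q = 1" "det2 q r = 1"
  shows "fst r = det2 p r * fst q - fst p" "snd r = det2 p r * snd q - snd p"
proof -
  have "det2 p r * fst q = det2 q r * fst p + det2 p q * fst r"
       "det2 p r * snd q = det2 q r * snd p + det2 p q * snd r"
    by (simp_all add: det2_def algebra_simps)
  then show "fst r = det2 p r * fst q - fst p" "snd r = det2 p r * snd q - snd p"
    using assms by simp_all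
qed

lemma rotate_map_periodic:
  fixes c :: "nat \<Rightarrow> 'b"
  assumes "\<And>t. c (t + n) = c t"
  shows "rotate k (map c [0..<n]) = map c [k..<k + n]"
proof (rule nth_equalityI)
  fix i assume "i < length (rotate k (map c [0..<n]))"
  then have i: "i < n" by simp
  have *: "c (j mod n) = c j" for j
  proof -
    have "c (j mod n + q * n) = c (j mod n)" for q
    proof (induction q)
      case (Suc q)
      have "c (j mod n + Suc q * n) = c ((j mod n + q * n) + n)" by (simp add: algebra_simps)
      then show ?case using Suc assms by simp
    qed simp
    from this[of "j div n"] show ?thesis by simp
  qed
  show "rotate k (map c [0..<n]) ! i = map c [k..<k + n] ! i"
    using i by (simp add: nth_rotate *)
qed simp

text \<open>\<open>elementary_matrix (c t)\<close> sends the column (x (t + 1), x t) to (x (t + 2),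
  x (t + 1)), so the matrix of a segment moves this state by \<open>k\<close> steps.\<close>

lemma continuant_matrix_walk:
  fixes x :: "nat \<Rightarrow> 'b::comm_ring_1"
  assumes "\<And>t. x (t + 2) = c t * x (t + 1) - x t"
  shows "x (t + k + 1) = continuant_matrix (map c [t..<t + k]) $ 1 $ 1 * x (t + 1)
           + continuant_matrix (map c [t..<t + k]) $ 1 $ 2 * x t \<and>
         x (t + k) = continuant_matrix (map c [t..<t + k]) $ 2 $ 1 * x (t + 1)
           + continuant_matrix (map c [t..<t + k]) $ 2 $ 2 * x t"
proof (induction k)
  case 0
  then show ?case by simp
next
  case (Suc k)
  have "x (t + Suc k + 1) = c (t + k) * x (t + k + 1) - x (t + k)"
    using assms[of "t + k"] by simp
  with Suc show ?case
    by (simp add: continuant_matrix_append matrix_mult_2_nth algebra_simps)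
qed

text \<open>If the tuple were a sum of \<open>a\<close> and \<open>b\<close> up to equivalence, the
  interior of \<open>b\<close> would be one of its cyclic segments, forwards or backwards, with
  (1,1) entry +-1. That entry is the determinant of two vectors of the walk, so it would be a
  chord.\<close>

lemma chordless_walk_Irr:
  fixes v :: "nat \<Rightarrow> 'b::comm_ring_1 \<times> 'b"
  assumes n: "n \<ge> 3"
    and per: "\<And>t. v (t + n) = v t"
    and adj: "\<And>t. det2 (v t) (v (t + 1)) = 1"
    and chord: "\<And>t k. 2 \<le> k \<Longrightarrow> k + 2 \<le> n \<Longrightarrow> det2 (v t) (v (t + k)) \<notin> {1, -1}"
  shows "map (\<lambda>t. det2 (v t) (v (t + 2))) [0..<n] \<in> Irr"
proof -
  define c where "c = (\<lambda>t. det2 (v t) (v (t + 2)))"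
  have cper: "c (t + n) = c t" for t
    using per[of t] per[of "t + 2"] by (simp add: c_def algebra_simps)
  have adj2: "det2 (v (t + 1)) (v (t + 2)) = 1" for t
    using adj[of "t + 1"] by simp
  have rec: "fst (v (t + 2)) = c t * fst (v (t + 1)) - fst (v t)"
            "snd (v (t + 2)) = c t * snd (v (t + 1)) - snd (v t)" for t
    using three_term_recurrence[OF adj[of t] adj2[of t]] unfolding c_def by blast+
  note walk1 = continuant_matrix_walk[of "\<lambda>t. fst (v t)" c, OF rec(1)]
  note walk2 = continuant_matrix_walk[of "\<lambda>t. snd (v t)" c, OF rec(2)]
  \<comment> \<open>The entries of a segment sit at the inner vectors, so \<open>k\<close> entries
    belong to a chord of \<open>k + 1\<close> steps.\<close>
  have seg: "continuant_matrix (map c [t..<t + k]) $ 1 $ 1 = det2 (v t) (v (t + (k + 1)))" for t k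
    using det2_coords(1)[OF adj, OF conjunct1[OF walk1] conjunct1[OF walk2]]
    by (simp add: add.assoc)
  have "lambda_quiddity (map c [0..<n])"
  proof -
    let ?M = "continuant_matrix (map c [0..<n])"
    have *: "v (n + 1) = v 1" "v n = v 0" using per[of 1] per[of 0] by (simp_all add: algebra_simps)
    \<comment> \<open>After a full period the first two vectors return. They form a basis, so the
      matrix is the identity.\<close>
    have "?M $ 1 $ 1 = 1" "?M $ 1 $ 2 = 0" "?M $ 2 $ 1 = 0" "?M $ 2 $ 2 = 1"
      using det2_coords[OF adj[of 0], of "v (n + 1)" "?M $ 1 $ 1" "?M $ 1 $ 2"]
        det2_coords[OF adj[of 0], of "v n" "?M $ 2 $ 1" "?M $ 2 $ 2"]
        walk1[of 0 n] walk2[of 0 n] adj[of 0]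
      unfolding add_0 * by (simp_all add: det2_def)
    then have "?M = mat 1" by (simp add: matrix_2_eq_iff)
    then show ?thesis using n by (auto simp: lambda_quiddity_def)
  qed
  moreover have "\<not> reducible (map c [0..<n])"
  proof
    assume "reducible (map c [0..<n])"
    then obtain a b where ab: "length a \<ge> 3" "length b \<ge> 3" "lambda_quiddity b"
      and eq: "tuple_equiv (map c [0..<n]) (tuple_sum a b)"
      unfolding reducible_def by blast
    obtain k where k: "tuple_sum a b = map c [k..<k + n] \<or> tuple_sum a b = rev (map c [k..<k + n])"
    proof -
      from eq obtain j where
        "tuple_sum a b = rotate j (map c [0..<n]) \<or> tuple_sum a b = rotate j (rev (map c [0..<n]))"
        unfolding tuple_equiv_def by blast
      then show ?thesis
        using that rotate_map_periodic[of c n, OF cper] by (metis rotate_rev)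
    qed
    have len: "length a + length b = n + 2"
      using length_tuple_sum[OF ab(1,2)] k by auto
    let ?s = "butlast (tl b)"
    have "b = hd b # ?s @ [last b]"
      using ab(2) by (cases b) (auto simp: last_tl)
    then have K: "continuant_matrix ?s $ 1 $ 1 \<in> {1, -1}"
      using lambda_quiddity_interior ab(3) by metis
    from k have "\<exists>t. continuant_matrix ?s $ 1 $ 1
        = continuant_matrix (map c [t..<t + (length b - 2)]) $ 1 $ 1"
    proof
      assume "tuple_sum a b = map c [k..<k + n]"
      then have "?s = map c [k + length a..<k + n]"
        using drop_tuple_sum[OF ab(1), of b] by (simp add: drop_map)
      moreover have "k + n = k + length a + (length b - 2)"
        using len ab(2) by linarith
      ultimately show ?thesis by metis
    next
      assume "tuple_sum a b = rev (map c [k..<k + n])"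
      then have "?s = rev (take (length b - 2) (map c [k..<k + n]))"
        using drop_tuple_sum[OF ab(1), of b] arg_cong[OF len, of "\<lambda>l. l - length a - 2"]
        by (simp add: drop_rev diff_right_commute)
      also have "\<dots> = rev (map c [k..<k + (length b - 2)])"
        using len ab by (simp add: take_map take_upt)
      finally show ?thesis
        using continuant_matrix_rev_nth by metis
    qed
    then obtain t where "continuant_matrix ?s $ 1 $ 1 = det2 (v t) (v (t + (length b - 2 + 1)))"
      using seg by metis
    \<comment> \<open>The two bounds come from \<open>length b \<ge> 3\<close> and
      \<open>length a \<ge> 3\<close>.\<close>
    moreover have "2 \<le> length b - 2 + 1" "length b - 2 + 1 + 2 \<le> n"
      using len ab by linarith+
    ultimately show False using K chord by metis
  qed
  moreover have "map c [0..<n] \<noteq> [0, 0]"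
  proof
    assume "map c [0..<n] = [0, 0]"
    then have "length (map c [0..<n]) = length [0, 0 :: 'b]" by (rule arg_cong)
    with n show False by simp
  qed
  ultimately show ?thesis unfolding Irr_def c_def by blast
qed

text \<open>A form for explicit constructions: one turn of the cycle is given and extended with
  period \<open>n\<close>.\<close>

lemma chordless_cycle_Irr:
  fixes v :: "nat \<Rightarrow> 'b::comm_ring_1 \<times> 'b"
  assumes n: "n \<ge> 3"
    and adj: "\<And>t. Suc t < n \<Longrightarrow> det2 (v t) (v (Suc t)) = 1"
    and closing: "det2 (v (n - 1)) (v 0) = 1"
    and chord: "\<And>s t. s < t \<Longrightarrow> t < n \<Longrightarrow> t \<noteq> Suc s \<Longrightarrow> \<not> (s = 0 \<and> t = n - 1) \<Longrightarrow>
                  det2 (v s) (v t) \<notin> {1, -1}"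
  shows "\<exists>c \<in> (Irr :: 'b list set). length c = n"
proof -
  define w where "w = (\<lambda>t. v (t mod n))"
  have "map (\<lambda>t. det2 (w t) (w (t + 2))) [0..<n] \<in> Irr"
  proof (rule chordless_walk_Irr[OF n])
    show "w (t + n) = w t" for t by (simp add: w_def)
    show "det2 (w t) (w (t + 1)) = 1" for t
    proof (cases "Suc (t mod n) = n")
      case True
      then have "Suc t mod n = 0" "t mod n = n - 1" by (simp_all add: mod_Suc)
      then show ?thesis using closing by (simp add: w_def)
    next
      case False
      then have "Suc t mod n = Suc (t mod n)" "Suc (t mod n) < n"
        using n mod_less_divisor[of n t] by (simp_all add: mod_Suc del: mod_less_divisor)
      then show ?thesis using adj[of "t mod n"] by (simp add: w_def)
    qed
    show "det2 (w t) (w (t + k)) \<notin> {1, -1}" if k: "2 \<le> k" "k + 2 \<le> n" for t k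
    proof (cases "t mod n + k < n")
      case True
      then have "(t + k) mod n = t mod n + k"
        by (metis mod_add_left_eq mod_less)
      moreover have "det2 (v (t mod n)) (v (t mod n + k)) \<notin> {1, -1}"
        by (rule chord) (use True k in linarith)+
      ultimately show ?thesis by (simp add: w_def)
    next
      case False
      \<comment> \<open>The pair straddles the end of the period. Its vectors occur in the opposite
        order, which only changes the sign of the determinant.\<close>
      have r: "t mod n < n" using n by simp
      have "(t + k) mod n = (t mod n + k - n) mod n"
        using False by (metis le_mod_geq mod_add_left_eq not_less)
      also have "\<dots> = t mod n + k - n" by (rule mod_less) (use r k in linarith)
      finally have e: "(t + k) mod n = t mod n + k - n" .
      have "det2 (v (t mod n + k - n)) (v (t mod n)) \<notin> {1, -1}"
        by (rule chord) (use False r k in linarith)+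
      then show ?thesis
        unfolding w_def e using det2_commute[of "v (t mod n)" "v (t mod n + k - n)"]
        by (auto simp: equation_minus_iff minus_equation_iff)
    qed
  qed
  then show ?thesis by (rule bexI[rotated]) simp
qed

section \<open>Polynomials over \<open>{0, 1, -1}\<close>\<close>

lemma reducibleI:
  assumes "lambda_quiddity c" "lambda_quiddity b" "length a \<ge> 3" "length b \<ge> 3"
    and "tuple_sum a b = rotate k c"
  shows "reducible c"
proof -
  have "length (tuple_sum a b) = length c" using assms(5) by simp
  then have "length c \<ge> 3"
    using length_tuple_sum[OF assms(3,4)] assms(3,4) by linarith
  then show ?thesis
    using assms unfolding reducible_def tuple_equiv_def by blast
qed

lemma rotate_to_last:
  assumes "x \<in> set c"
  obtains k d where "rotate k c = d @ [x]"
proof -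
  obtain us ws where c: "c = us @ x # ws" using assms by (meson split_list)
  have "rotate (length (us @ [x])) ((us @ [x]) @ ws) = ws @ us @ [x]"
    using rotate_append[of "us @ [x]" ws] by simp
  then have "rotate (length (us @ [x])) c = (ws @ us) @ [x]"
    using c by simp
  then show ?thesis by (rule that)
qed

lemma hd_mid_last: "length d \<ge> 2 \<Longrightarrow> d = hd d # butlast (tl d) @ [last d]"
  by (cases d) (auto simp: last_tl)

lemma lambda_quiddity_pm1_triple:
  "\<epsilon> \<in> {1, -1} \<Longrightarrow> lambda_quiddity [\<epsilon>, \<epsilon>, \<epsilon> :: 'b::comm_ring_1]"
  by (auto simp: lambda_quiddity_def matrix_2_eq_iff matrix_mult_2_nth)

lemma lambda_quiddity_zero_quadruples:
  "lambda_quiddity [0, x, 0, - x :: 'b::comm_ring_1]"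
  "lambda_quiddity [x, 0, - x, 0 :: 'b::comm_ring_1]"
  by (auto simp: lambda_quiddity_def matrix_2_eq_iff matrix_mult_2_nth)

text \<open>The triple (\<epsilon>, \<epsilon>, \<epsilon>) is cut off at the entry \<epsilon>: this
  entry disappears and \<epsilon> is subtracted from both neighbours.\<close>

lemma reducible_of_pm1_mem:
  fixes c :: "'b::comm_ring_1 list"
  assumes c: "lambda_quiddity c" "length c \<ge> 4" and e: "\<epsilon> \<in> set c" "\<epsilon> \<in> {1, -1}"
  shows "reducible c"
proof -
  obtain k d where rot: "rotate k c = d @ [\<epsilon>]" using rotate_to_last[OF e(1)] by blast
  have "length (rotate k c) = length d + 1" unfolding rot by simp
  with c have d: "length d \<ge> 3" by simp
  define a where "a = [hd d - \<epsilon>] @ butlast (tl d) @ [last d - \<epsilon>]"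
  have "tuple_sum a [\<epsilon>, \<epsilon>, \<epsilon>] = (hd d # butlast (tl d) @ [last d]) @ [\<epsilon>]"
    by (simp add: tuple_sum_def a_def)
  then have "tuple_sum a [\<epsilon>, \<epsilon>, \<epsilon>] = rotate k c"
    unfolding rot using hd_mid_last[of d] d by simp
  moreover have "length a \<ge> 3" using d by (simp add: a_def)
  ultimately show ?thesis
    using reducibleI[OF c(1) lambda_quiddity_pm1_triple[OF e(2)], of a k] by simp
qed

text \<open>The quadruple (-y, 0, y, 0) is cut off at 0 and the entry \<open>y\<close> that follows
  it cyclically: both disappear and \<open>y\<close> is added to the entry before 0. Length 5 leaves
  the three entries that a summand needs.\<close>

lemma reducible_of_zero_mem:
  fixes c :: "'b::comm_ring_1 list"
  assumes c: "lambda_quiddity c" "length c \<ge> 5" and z: "0 \<in> set c"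
  shows "reducible c"
proof -
  obtain k d where "rotate k c = d @ [0]" using rotate_to_last[OF z] by blast
  moreover have "length (rotate k c) = length c" by simp
  ultimately obtain y e where "rotate k c = y # e @ [0]" and e: "length e \<ge> 3"
    using c(2) by (cases d) auto
  then have rot: "rotate (Suc k) c = e @ [0, y]"
    by simp
  define a where "a = [hd e] @ butlast (tl e) @ [last e + y]"
  have "tuple_sum a [- y, 0, y, 0] = (hd e # butlast (tl e) @ [last e]) @ [0, y]"
    by (simp add: tuple_sum_def a_def)
  then have "tuple_sum a [- y, 0, y, 0] = rotate (Suc k) c"
    unfolding rot using hd_mid_last[of e] e by simp
  moreover have "length a \<ge> 3" using e by (simp add: a_def)
  moreover have "lambda_quiddity [- y, 0, y, 0]"
    using lambda_quiddity_zero_quadruples(2)[of "- y"] by simp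
  ultimately show ?thesis
    using reducibleI[OF c(1), of "[- y, 0, y, 0]" a "Suc k"] by simp
qed

section \<open>Quiddities with at most four entries\<close>

lemma not_lambda_quiddity_singleton: "\<not> lambda_quiddity [x :: 'b::comm_ring_1]"
  by (auto simp: lambda_quiddity_def matrix_2_eq_iff)

lemma lambda_quiddity_pair: "lambda_quiddity [x, y :: 'b::comm_ring_1] \<Longrightarrow> x = 0 \<and> y = 0"
  by (auto simp: lambda_quiddity_def matrix_2_eq_iff matrix_mult_2_nth)

lemma lambda_quiddity_triple:
  fixes x y z :: "'b::comm_ring_1"
  assumes "lambda_quiddity [x, y, z]"
  shows "[x, y, z] \<in> {[1, 1, 1], [-1, -1, -1]}"
proof -
  obtain \<epsilon> :: 'b where e: "\<epsilon> \<in> {1, -1}" and M: "continuant_matrix [x, y, z] = mat \<epsilon>"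
    using assms unfolding lambda_quiddity_def by blast
  have eqs: "1 - z * y = 0" "y * x - 1 = 0" "- y = \<epsilon>"
    using arg_cong[OF M, of "\<lambda>A. A $ 1 $ 2"] arg_cong[OF M, of "\<lambda>A. A $ 2 $ 1"]
      arg_cong[OF M, of "\<lambda>A. A $ 2 $ 2"]
    by (simp_all add: matrix_mult_2_nth)
  then have y: "y = 1 \<or> y = -1" using e by (auto simp: minus_equation_iff)
  have "z * y = 1" "y * x = 1" using eqs by simp_all
  with y show ?thesis by (auto simp: minus_equation_iff)
qed

text \<open>For \<epsilon> = 1 opposite entries are negatives of each other; for \<epsilon> = -1
  they are equal and \<open>y * x\<close> is 2. In the second case an entry 0 forces 2 = 0, and
  signs no longer matter.\<close>

lemma lambda_quiddity_quadruple_zero: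
  fixes x y z w :: "'b::comm_ring_1"
  assumes "lambda_quiddity [x, y, z, w]" and zero: "0 \<in> {x, y, z, w}"
  shows "[x, y, z, w] \<in> {[0, y, 0, - y], [x, 0, - x, 0]}"
proof -
  obtain \<epsilon> :: 'b where e: "\<epsilon> \<in> {1, -1}" and M: "continuant_matrix [x, y, z, w] = mat \<epsilon>"
    using assms unfolding lambda_quiddity_def by blast
  have e1: "w * (z * (y * x - 1) - x) - (y * x - 1) = \<epsilon>"
    using arg_cong[OF M, of "\<lambda>A. A $ 1 $ 1"] by (simp add: matrix_mult_2_nth algebra_simps)
  have e2: "w * (1 - z * y) + y = 0"
    using arg_cong[OF M, of "\<lambda>A. A $ 1 $ 2"] by (simp add: matrix_mult_2_nth algebra_simps)
  have e3: "z * (y * x - 1) - x = 0"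
    using arg_cong[OF M, of "\<lambda>A. A $ 2 $ 1"] by (simp add: matrix_mult_2_nth algebra_simps)
  have e4: "1 - z * y = \<epsilon>"
    using arg_cong[OF M, of "\<lambda>A. A $ 2 $ 2"] by (simp add: matrix_mult_2_nth)
  have yx: "y * x - 1 = - \<epsilon>" using e1[unfolded e3] by (metis diff_0 minus_diff_eq mult_zero_right)
  have x: "x = - (z * \<epsilon>)" using e3[unfolded yx] by (simp add: eq_neg_iff_add_eq_0 add.commute)
  have xy: "y * x = 1 - \<epsilon>" using yx by (simp add: algebra_simps)
  have y: "y = - (w * \<epsilon>)" using e2 e4 by (simp add: eq_neg_iff_add_eq_0 add.commute)
  from e consider "\<epsilon> = 1" | "\<epsilon> = -1" by blast
  then show ?thesis
  proof cases
    case 1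
    then have "z = - x" "w = - y" "y * x = 0" using x y xy by simp_all
    then show ?thesis using zero by auto
  next
    case 2
    then have zw: "z = x" "w = y" and two: "y * x = 1 + 1" using x y xy by simp_all
    then have "(1 :: 'b) + 1 = 0" using zero by auto
    then have "- u = u" for u :: 'b
      by (metis mult.left_neutral mult_zero_left distrib_right neg_eq_iff_add_eq_0)
    then show ?thesis using zw zero by auto
  qed
qed

lemma not_reducible_triple: "\<not> reducible [x, y, z]"
proof
  assume "reducible [x, y, z]"
  then obtain a b k where ab: "length a \<ge> 3" "length b \<ge> 3"
    and "tuple_sum a b = rotate k [x, y, z] \<or> tuple_sum a b = rotate k (rev [x, y, z])"
    unfolding reducible_def tuple_equiv_def by blast
  then have "length (tuple_sum a b) = 3" by auto
  with length_tuple_sum[OF ab] ab show False by simp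
qed

text \<open>The lengths leave only a triple for \<open>b\<close>, and its middle entry, which is
  +-1, survives in the sum.\<close>

lemma reducible_quadruple_pm1_mem:
  assumes "reducible c" "length c = 4"
  shows "\<exists>\<epsilon> \<in> {1, -1}. \<epsilon> \<in> set c"
proof -
  obtain a b k where ab: "length a \<ge> 3" "length b \<ge> 3" "lambda_quiddity b"
    and k: "tuple_sum a b = rotate k c \<or> tuple_sum a b = rotate k (rev c)"
    using assms(1) unfolding reducible_def tuple_equiv_def by blast
  then have "length (tuple_sum a b) = 4" using assms(2) by auto
  with length_tuple_sum[OF ab(1,2)] ab have "length b = 3" by simp
  then obtain x y z where b: "b = [x, y, z]"
    by (auto simp: length_Suc_conv numeral_3_eq_3)
  have "y \<in> {1, -1}" using lambda_quiddity_triple ab(3) unfolding b by fastforce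
  moreover have "y \<in> set (tuple_sum a b)" unfolding b tuple_sum_def by simp
  then have "y \<in> set c" using k by auto
  ultimately show ?thesis by blast
qed

text \<open>If every entry were nonconstant, the upper entry of the first column of the matrix would
  always have larger degree than the lower one. Each further factor moves the upper entry down, so
  the lower one could not be 0 as in a quiddity.\<close>

lemma lambda_quiddity_poly_degree_0:
  fixes c :: "'a::comm_ring_1 poly list"
  assumes pm1: "\<And>x :: 'a. x \<in> {0, 1, -1}" and "lambda_quiddity c"
  shows "\<exists>p \<in> set c. degree p = 0"
proof (rule ccontr)
  assume neg: "\<not> ?thesis"
  \<comment> \<open>Every nonzero element is +-1, so leading coefficients do not annihilate each
    other.\<close>
  have no_zero_div: "x * y \<noteq> 0" if "x \<noteq> 0" "y \<noteq> 0" for x y :: 'a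
    using that pm1[of x] pm1[of y] by (elim insertE) simp_all
  have *: "ds \<noteq> [] \<Longrightarrow> (\<forall>p \<in> set ds. degree p \<noteq> 0) \<Longrightarrow>
      continuant_matrix ds $ 2 $ 1 \<noteq> 0 \<and>
      degree (continuant_matrix ds $ 2 $ 1) < degree (continuant_matrix ds $ 1 $ 1)"
    for ds :: "'a poly list"
  \<comment> \<open>An appended entry multiplies from the left and so acts on the first column
    alone, by (K, L) -> (p * K - L, K).\<close>
  proof (induction ds rule: rev_induct)
    case (snoc p ds)
    define K where "K = continuant_matrix ds $ 1 $ 1"
    define L where "L = continuant_matrix ds $ 2 $ 1"
    have M: "continuant_matrix (ds @ [p]) $ 1 $ 1 = p * K - L"
            "continuant_matrix (ds @ [p]) $ 2 $ 1 = K"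
      by (simp_all add: continuant_matrix_append matrix_mult_2_nth K_def L_def)
    show ?case
    proof (cases "ds = []")
      case True
      then show ?thesis using snoc.prems by (simp add: matrix_mult_2_nth)
    next
      case False
      then have KL: "degree L < degree K"
        using snoc.IH snoc.prems(2) unfolding K_def L_def by simp
      have p: "degree p > 0" using snoc.prems by simp
      have "lead_coeff p \<noteq> 0" "lead_coeff K \<noteq> 0"
        using p KL by auto
      then have "lead_coeff p * lead_coeff K \<noteq> 0" by (rule no_zero_div)
      then have "coeff (p * K) (degree p + degree K) \<noteq> 0"
        by (simp add: coeff_mult_degree_sum)
      moreover have "coeff L (degree p + degree K) = 0"
        using KL by (intro coeff_eq_0) simp
      ultimately have "degree (p * K - L) \<ge> degree p + degree K"
        by (intro le_degree) simp
      then have "degree K < degree (p * K - L)" using p by linarith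
      moreover have "K \<noteq> 0" using KL by auto
      ultimately show ?thesis unfolding M by blast
    qed
  qed simp
  have "c \<noteq> []" "continuant_matrix c $ 2 $ 1 = 0"
    using assms(2) unfolding lambda_quiddity_def by auto
  moreover have "\<forall>p \<in> set c. degree p \<noteq> 0" using neg by simp
  ultimately show False using *[of c] by simp
qed

text \<open>An entry of degree 0 is one of 0, 1, -1. Cutting there excludes all lengths from 5 on,
  and entries +-1 in length 4. Conversely, a reducible quadruple contains +-1, which the condition
  on \<open>P\<close> rules out.\<close>

lemma Irr_poly_prime_field:
  assumes pm1: "\<And>x :: 'a::comm_ring_1. x \<in> {0, 1, -1}"
  shows "(Irr :: 'a poly list set) =
            {[1, 1, 1], [-1, -1, -1]}
            \<union> {[0, P, 0, -P] | P. P \<notin> {1, -1}}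
            \<union> {[P, 0, -P, 0] | P. P \<notin> {1, -1}}" (is "_ = ?R")
proof (intro equalityI subsetI)
  fix c :: "'a poly list" assume "c \<in> Irr"
  then have q: "lambda_quiddity c" and irr: "\<not> reducible c" and nz: "c \<noteq> [0, 0]"
    by (auto simp: Irr_def)
  obtain p where p: "p \<in> set c" "degree p = 0"
    using lambda_quiddity_poly_degree_0[OF pm1 q] by blast
  then obtain x where "p = [:x:]" by (meson degree_eq_zeroE)
  then have p01: "p \<in> {0, 1, -1}" using pm1[of x] by (auto simp: one_pCons)
  have "length c < 5"
    using p p01 irr reducible_of_zero_mem[OF q] reducible_of_pm1_mem[OF q, of p] by force
  moreover have "length c \<noteq> 0" using q by (simp add: lambda_quiddity_def)
  ultimately consider "length c = 1" | "length c = 2" | "length c = 3" | "length c = 4"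
    by linarith
  then show "c \<in> ?R"
  proof cases
    case 1
    then show ?thesis using q not_lambda_quiddity_singleton
      by (auto simp: length_Suc_conv)
  next
    case 2
    then show ?thesis using q lambda_quiddity_pair nz
      by (auto simp: length_Suc_conv numeral_2_eq_2)
  next
    case 3
    then obtain x y z where "c = [x, y, z]" by (auto simp: length_Suc_conv numeral_3_eq_3)
    then show ?thesis using lambda_quiddity_triple[of x y z] q by simp
  next
    case 4
    then obtain x y z w where c: "c = [x, y, z, w]"
      by (auto simp: length_Suc_conv numeral_eq_Suc)
    have npm: "\<epsilon> \<notin> set c" if "\<epsilon> \<in> {1, -1}" for \<epsilon>
      using reducible_of_pm1_mem[OF q] irr 4 that by auto
    then have "p = 0" using p p01 by auto
    then have "0 \<in> {x, y, z, w}" using p(1) c by simp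
    then have "c \<in> {[0, y, 0, - y], [x, 0, - x, 0]}"
      using lambda_quiddity_quadruple_zero q unfolding c by blast
    moreover have "x \<notin> {1, -1}" "y \<notin> {1, -1}" using npm c by auto
    ultimately show ?thesis by blast
  qed
next
  fix c :: "'a poly list" assume "c \<in> ?R"
  then consider (triple) "c = [1, 1, 1] \<or> c = [-1, -1, -1]"
    | (quadruple) P where "P \<notin> {1, -1}" "c = [0, P, 0, -P] \<or> c = [P, 0, -P, 0]"
    by blast
  then show "c \<in> Irr"
  proof cases
    case triple
    then show ?thesis
      using lambda_quiddity_pm1_triple[of 1] lambda_quiddity_pm1_triple[of "-1"] not_reducible_triple
      by (auto simp: Irr_def)
  next
    case quadruple
    then have "\<not> (\<exists>\<epsilon> \<in> {1, -1}. \<epsilon> \<in> set c)" "length c = 4"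
      by (auto simp: minus_equation_iff)
    then have "\<not> reducible c" using reducible_quadruple_pm1_mem by blast
    then show ?thesis
      using quadruple lambda_quiddity_zero_quadruples[of P] by (auto simp: Irr_def)
  qed
qed

lemma ell_poly_prime_field:
  assumes pm1: "\<And>x :: 'a::comm_ring_1. x \<in> {0, 1, -1}"
  shows "ell TYPE('a poly) = 4"
proof -
  note I = Irr_poly_prime_field[OF pm1]
  have len: "length ` (Irr :: 'a poly list set) = {3, 4}"
  proof (intro equalityI subsetI)
    fix n assume "n \<in> length ` (Irr :: 'a poly list set)"
    then show "n \<in> {3, 4}" unfolding I by auto
  next
    have "[1, 1, 1] \<in> (Irr :: 'a poly list set)" unfolding I by simp
    moreover have "[0, 0, 0, 0] \<in> (Irr :: 'a poly list set)" unfolding I by force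
    moreover fix n :: nat assume "n \<in> {3, 4}"
    ultimately show "n \<in> length ` (Irr :: 'a poly list set)" by force
  qed
  have "\<forall>c \<in> (Irr :: 'a poly list set). length c \<le> 4" unfolding I by auto
  then show ?thesis
    unfolding ell_def len by (auto simp: numeral_eq_enat)
qed

section \<open>Rings whose only elements are 0, 1 and -1\<close>

lemma bit0_num1_cases: "(x :: 2) = 0 \<or> x = 1"
proof -
  have "card {0, 1 :: 2} = CARD(2)" by simp
  then have "{0, 1 :: 2} = UNIV" by (intro card_subset_eq) auto
  then show ?thesis by blast
qed

lemma bit1_num1_cases: "(x :: 3) \<in> {0, 1, -1}"
proof -
  have "(1 :: 3) \<noteq> -1" by (simp add: eq_neg_iff_add_eq_0)
  then have "card {0, 1, -1 :: 3} = CARD(3)" by simp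
  then have "{0, 1, -1 :: 3} = UNIV" by (intro card_subset_eq) auto
  then show ?thesis by blast
qed

lemma ring_isomorphism_pm1:
  fixes f :: "'a::comm_ring_1 \<Rightarrow> 'b::comm_ring_1"
  assumes f: "ring_isomorphism f" and pm1: "\<And>y :: 'b. y \<in> {0, 1, -1}"
  shows "(x :: 'a) \<in> {0, 1, -1}"
proof -
  have add: "f (u + v) = f u + f v" for u v using f by (simp add: ring_isomorphism_def)
  have inj: "f u = f v \<Longrightarrow> u = v" for u v
    using f by (auto simp: ring_isomorphism_def bij_def inj_def)
  have f1: "f 1 = 1" using f by (simp add: ring_isomorphism_def)
  have f0: "f 0 = 0" using add[of 0 0] by simp
  have fm1: "f (-1) = -1" using add[of 1 "-1"] f0 f1 by (simp add: eq_neg_iff_add_eq_0 add.commute)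
  show ?thesis using pm1[of "f x"] inj f0 f1 fm1 by (metis insert_iff empty_iff)
qed

text \<open>Such a ring has two elements if 1 = -1 and three otherwise, and the value of 1 + 1
  determines its addition.\<close>

lemma ring_isomorphism_prime_field:
  assumes pm1: "\<And>x :: 'a::comm_ring_1. x \<in> {0, 1, -1}"
  shows "(\<exists>f :: 'a \<Rightarrow> 2. ring_isomorphism f) \<or> (\<exists>f :: 'a \<Rightarrow> 3. ring_isomorphism f)"
proof (cases "(1 :: 'a) = -1")
  case True
  then have all: "x = 0 \<or> x = 1" for x :: 'a using pm1[of x] by auto
  have two: "(1 :: 'a) + 1 = 0" by (subst (2) True) simp
  define f :: "'a \<Rightarrow> 2" where "f x = (if x = 0 then 0 else 1)" for x
  have f: "f 0 = 0" "f 1 = 1" by (simp_all add: f_def)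
  have "f (x + y) = f x + f y" for x y
    using all[of x] all[of y]
  proof (elim disjE)
    assume "x = 1" "y = 1"
    moreover have "(1 :: 2) + 1 = 0" by simp
    ultimately show ?thesis using two by (simp only: f)
  qed (simp_all add: f)
  moreover have "f (x * y) = f x * f y" for x y
    using all[of x] all[of y] by (elim disjE) (simp_all add: f)
  moreover have "inj f"
    by (rule injI) (metis all f zero_neq_one)
  moreover have "surj f"
  proof -
    have "y \<in> range f" for y
      using bit0_num1_cases[of y] f by (metis rangeI)
    then show ?thesis by blast
  qed
  ultimately show ?thesis using f unfolding ring_isomorphism_def bij_def by blast
next
  case False
  have "(1 :: 'a) + 1 \<noteq> 0"
    using False by (simp only: eq_neg_iff_add_eq_0 simp_thms)
  moreover have "(1 :: 'a) + 1 \<noteq> 1"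
    by (simp only: add_cancel_left_right one_neq_zero simp_thms)
  ultimately have three: "(1 :: 'a) + 1 = -1"
    using pm1[of "1 + 1"] by blast
  have three': "(-1 :: 'a) + -1 = 1"
    using arg_cong[OF three, of uminus] by (simp only: minus_add_distrib minus_minus)
  define f :: "'a \<Rightarrow> 3" where "f x = (if x = 0 then 0 else if x = 1 then 1 else -1)" for x
  have f: "f 0 = 0" "f 1 = 1" "f (-1) = -1" using False by (auto simp: f_def)
  have b: "(1 :: 3) + 1 = -1" "(-1 :: 3) + -1 = 1" by simp_all
  have "f (x + y) = f x + f y" for x y
  proof -
    have "x = 0 \<or> x = 1 \<or> x = -1" "y = 0 \<or> y = 1 \<or> y = -1" using pm1 by blast+
    then show ?thesis
      by (elim disjE)
        (simp_all only: three three' f b add_0_left add_0_right add.right_inverse add.left_inverse)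
  qed
  moreover have "f (x * y) = f x * f y" for x y
  proof -
    have "x = 0 \<or> x = 1 \<or> x = -1" "y = 0 \<or> y = 1 \<or> y = -1" using pm1 by blast+
    then show ?thesis
      by (elim disjE)
        (simp_all only: f mult_zero_left mult_zero_right mult_1_left mult_1_right
          minus_mult_minus)
  qed
  moreover have "inj f"
  proof (rule injI)
    fix x y :: 'a assume eq: "f x = f y"
    have "(1 :: 3) \<noteq> -1" by (simp add: eq_neg_iff_add_eq_0)
    with eq show "x = y" unfolding f_def
      using pm1[of x] pm1[of y] by (auto split: if_splits)
  qed
  moreover have "surj f"
  proof -
    have "y \<in> range f" for y :: 3
      using bit1_num1_cases[of y] f by (metis insert_iff empty_iff rangeI)
    then show ?thesis by blast
  qed
  ultimately show ?thesis using f unfolding ring_isomorphism_def bij_def by blast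
qed

section \<open>Long irreducible quiddities\<close>

text \<open>For \<open>n > 0\<close> this is the image over the given ring of the integer polynomial
  U(X/2), with U the Chebyshev polynomial of the second kind of index \<open>n - 1\<close>. It is
  monic of degree \<open>n - 1\<close>.\<close>

fun cheb :: "nat \<Rightarrow> 'a::comm_ring_1 poly" where
  "cheb 0 = 0"
| "cheb (Suc 0) = 1"
| "cheb (Suc (Suc n)) = pCons 0 (cheb (Suc n)) - cheb n"

lemma coeff_cheb_ge: "n \<le> k \<Longrightarrow> coeff (cheb n) k = 0"
  by (induction n arbitrary: k rule: cheb.induct) (auto simp: coeff_pCons split: nat.split)

lemma coeff_cheb_top: "coeff (cheb (Suc n)) n = 1"
proof (induction n)
  case (Suc n)
  then show ?case by (simp add: coeff_pCons coeff_cheb_ge)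
qed simp

definition path_vec :: "nat \<Rightarrow> 'a::comm_ring_1 poly \<times> 'a poly" where
  "path_vec i = (cheb (Suc i), cheb i)"

text \<open>One step along the path is a linear map of determinant 1, so only the distance
  matters.\<close>

lemma det2_path_vec_add: "det2 (path_vec i) (path_vec (i + d)) = cheb d"
proof (induction i)
  case 0
  then show ?case by (simp add: det2_def path_vec_def)
next
  case (Suc i)
  define x where "x = [:0, 1 :: 'a:]"
  have rec: "cheb (Suc (Suc n)) = x * cheb (Suc n) - cheb n" for n
    by (simp add: x_def)
  show ?case
    unfolding Suc.IH[symmetric]
    by (simp add: det2_def path_vec_def rec algebra_simps del: cheb.simps(3))
qed

lemma det2_path_vec:
  "det2 (path_vec i) (path_vec j) = (if i \<le> j then cheb (j - i) else - cheb (i - j))"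
proof (cases "i \<le> j")
  case True
  then show ?thesis using det2_path_vec_add[of i "j - i"] by simp
next
  case False
  then show ?thesis
    using det2_path_vec_add[of j "i - j"] by (subst det2_commute) simp
qed

definition scale2 :: "'b::comm_ring_1 \<Rightarrow> 'b \<times> 'b \<Rightarrow> 'b \<times> 'b" where
  "scale2 z v = (z * fst v, z * snd v)"

lemma det2_linear [simp]:
  "det2 (scale2 z v) w = z * det2 v w" "det2 v (scale2 z w) = z * det2 v w"
  "det2 (v + v') w = det2 v w + det2 v' w" "det2 v (w + w') = det2 v w + det2 v w'"
  "det2 (v - v') w = det2 v w - det2 v' w" "det2 v (w - w') = det2 v w - det2 v w'"
  "det2 (- v) w = - det2 v w" "det2 v (- w) = - det2 v w"
  by (simp_all add: det2_def scale2_def algebra_simps)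

section \<open>Comparing degrees in the presence of zero divisors\<close>

lemma coeff_mult_pm1:
  "p \<in> {1, -1} \<Longrightarrow> k > 0 \<Longrightarrow> coeff ([:e:] * p) k = (0 :: 'a::comm_ring_1)"
  by (cases k) auto

text \<open>
  Degrees are compared after multiplication by a constant \<open>e\<close> with \<open>e\<^sup>2 = 0\<close>, which turns the unit
  \<open>1 + e X\<close> into a constant; constant units are treated alike with \<open>e = 1\<close>.
\<close>

definition low :: "'a::comm_ring_1 \<Rightarrow> nat \<Rightarrow> 'a poly \<Rightarrow> bool" where
  "low e d q \<longleftrightarrow> (\<forall>k \<ge> d - 1. coeff ([:e:] * q) k = 0)"

text \<open>The inverse \<open>c'\<close> ensures that \<open>e * c\<close>, which will appear as a
  leading coefficient, is nonzero whenever \<open>e\<close> is.\<close>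

definition unit_mult :: "'a::comm_ring_1 \<Rightarrow> 'a poly \<Rightarrow> bool" where
  "unit_mult e z \<longleftrightarrow> (\<exists>c c'. c * c' = 1 \<and> [:e:] * z = [:e * c:])"

lemma low_zero: "low e d 0"
  by (simp add: low_def)

lemma low_add: "low e d p \<Longrightarrow> low e d q \<Longrightarrow> low e d (p + q)"
  by (simp add: low_def distrib_left)

lemma unit_mult_one: "unit_mult e 1"
  unfolding unit_mult_def by (rule exI[of _ 1], rule exI[of _ 1]) simp

lemma unit_mult_minus: "unit_mult e z \<Longrightarrow> unit_mult e (- z)"
  unfolding unit_mult_def by (metis minus_mult_minus minus_pCons mult_minus_right minus_zero)

lemma unit_mult_mult:
  assumes "unit_mult e y" "unit_mult e z"
  shows "unit_mult e (y * z)"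
proof -
  obtain c c' where c: "c * c' = 1" "[:e:] * y = [:e * c:]"
    using assms(1) by (auto simp: unit_mult_def)
  obtain d d' where d: "d * d' = 1" "[:e:] * z = [:e * d:]"
    using assms(2) by (auto simp: unit_mult_def)
  have "[:e:] * (y * z) = [:e * c:] * z"
    by (simp only: c(2)[symmetric] mult.assoc)
  also have "\<dots> = [:c:] * ([:e:] * z)" by (simp add: mult.commute)
  also have "\<dots> = [:e * (c * d):]" unfolding d(2) by (simp add: algebra_simps)
  finally have "[:e:] * (y * z) = [:e * (c * d):]" .
  moreover have "(c * d) * (c' * d') = (c * c') * (d * d')" by (simp only: mult_ac)
  then have "(c * d) * (c' * d') = 1" using c d by simp
  ultimately show ?thesis unfolding unit_mult_def by blast
qed

lemma low_cheb:
  assumes "unit_mult e z" "d' < d"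
  shows "low e d (z * cheb d')"
proof -
  obtain c where c: "[:e:] * z = [:c:]" using assms(1) by (auto simp: unit_mult_def)
  have "[:e:] * (z * cheb d') = [:c:] * cheb d'"
    by (simp only: c[symmetric] mult.assoc)
  then show ?thesis using assms(2) by (simp add: low_def coeff_cheb_ge)
qed

text \<open>After multiplication by \<open>e\<close>, the coefficient at \<open>d - 1\<close> is
  \<open>e * c\<close> with \<open>c\<close> invertible, whereas +-1 gives 0 there because
  \<open>d - 1 > 0\<close>.\<close>

lemma low_plus_cheb_not_pm1:
  assumes e: "e \<noteq> 0" and z: "unit_mult e z" and q: "low e d q" and d: "d \<ge> 2"
  shows "q + z * cheb d \<notin> {1, -1}"
proof
  assume pm1: "q + z * cheb d \<in> {1, -1}"
  obtain c c' where c: "c * c' = 1" "[:e:] * z = [:e * c:]"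
    using z by (auto simp: unit_mult_def)
  have "[:e:] * (q + z * cheb d) = [:e:] * q + [:e * c:] * cheb d"
    by (simp only: c(2)[symmetric] mult.assoc distrib_left)
  moreover have "coeff (cheb d) (d - 1) = (1 :: 'a)"
    using coeff_cheb_top[of "d - 1"] d by simp
  ultimately have "coeff ([:e:] * (q + z * cheb d)) (d - 1) = e * c"
    using q by (simp add: low_def)
  then have "e * c = 0" using coeff_mult_pm1[OF pm1, of "d - 1" e] d by simp
  then have "e * (c * c') = 0" by (simp only: mult.assoc[symmetric] mult_zero_left)
  with c e show False by simp
qed

lemma cheb_not_pm1:
  assumes "e \<noteq> 0" "unit_mult e z" "d \<ge> 2"
  shows "z * cheb d \<notin> {1, -1}"
  using low_plus_cheb_not_pm1[OF assms(1,2) low_zero assms(3)] by simp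

lemma two_cheb_not_pm1:
  assumes "e \<noteq> 0" "unit_mult e z" "unit_mult e y" "d' < d" "d \<ge> 2"
  shows "y * cheb d' + z * cheb d \<notin> {1, -1}"
  by (rule low_plus_cheb_not_pm1) (use assms low_cheb in auto)

text \<open>The cycle is p_0, ..., p_m, \<open>w'\<close>, then multiples of p_(m-1), ..., p_1, then
  \<open>w\<close>. The determinant of two nonadjacent vectors is 0, +-u or +-u', or it has positive
  degree after multiplication by \<open>e\<close>.\<close>

lemma Irr_of_unit:
  fixes u u' :: "'a::comm_ring_1 poly"
  assumes uu: "u * u' = 1" and u: "u \<notin> {1, -1}"
    and e: "e \<noteq> 0" and ue: "unit_mult e u" and ue': "unit_mult e u'"
    and m: "even m" "m \<ge> 2"
  shows "\<exists>c \<in> (Irr :: 'a poly list set). length c = 2 * m + 2"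
proof -
  have u': "u' \<notin> {1, -1}" using uu u by (auto simp: minus_equation_iff)
  \<comment> \<open>A step back along the path has determinant -1; consecutive factors have product
    -1 and correct this.\<close>
  define \<sigma> where "\<sigma> j = (if odd j then u else - u')" for j :: nat
  \<comment> \<open>\<open>w\<close> and \<open>w'\<close> join the two copies: their determinants
    with the neighbours are 1. As \<open>m\<close> is even, the neighbours on the scaled side are
    \<open>u\<close> times p_1 and p_(m-1).\<close>
  define w where "w = - (path_vec 1 + scale2 u' (path_vec 0))"
  define w' where "w' = - (path_vec (m - 1) + scale2 u' (path_vec m))"
  define v where "v t = (if t \<le> m then path_vec t
     else if t = m + 1 then w'
     else if t \<le> 2 * m then scale2 (\<sigma> (2 * m + 1 - t)) (path_vec (2 * m + 1 - t))
     else w)" for t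
  have s_e: "unit_mult e (\<sigma> j)" for j
    using ue ue' by (simp add: \<sigma>_def unit_mult_minus)
  have s_ne: "\<sigma> j \<notin> {1, -1}" for j
    using u u' by (auto simp: \<sigma>_def minus_equation_iff)
  have neg: "- x \<notin> {1, -1} \<longleftrightarrow> x \<notin> {1, -1}" for x :: "'a poly"
    by (auto simp: minus_equation_iff)
  have ss: "\<sigma> j * \<sigma> (Suc j) = -1" for j
    using uu by (simp add: \<sigma>_def mult.commute)
  have Kaw': "det2 (path_vec i) w' = - (1 * cheb (m - 1 - i) + u' * cheb (m - i))" if "i < m" for i
    using that by (simp add: w'_def det2_path_vec)
  have Kaw: "det2 (path_vec i) w = 1 * cheb (i - 1) + u' * cheb i" if "i \<ge> 1" for i
    using that by (simp add: w_def det2_path_vec)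
  have Kw'a: "det2 w' (path_vec i) = 1 * cheb (m - 1 - i) + u' * cheb (m - i)" if "i < m" for i
    using Kaw'[OF that] by (subst det2_commute) simp
  have Kw'w: "det2 w' w = - ((1 * cheb (m - 2) + u' * cheb (m - 1) + u' * cheb (m - 1))
      + (u' * u') * cheb m)"
    using m by (simp add: w_def w'_def det2_path_vec algebra_simps numeral_2_eq_2)
  have low1: "1 * cheb d + u' * cheb (Suc d) \<notin> {1, -1}" for d
  proof (cases "d = 0")
    case True
    then show ?thesis using u' by simp
  next
    case False
    then show ?thesis by (intro two_cheb_not_pm1[OF e ue' unit_mult_one]) auto
  qed
  \<comment> \<open>For \<open>d = 0\<close> the value is \<open>\<sigma> j * u'\<close>, which is 1
    on the edges joining \<open>w'\<close> and \<open>w\<close> to the scaled copy.\<close>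
  have low2: "\<sigma> j * (1 * cheb d + u' * cheb (Suc d)) \<notin> {1, -1}" if "d \<ge> 1" for j d
  proof -
    have "\<sigma> j * cheb d + (\<sigma> j * u') * cheb (Suc d) \<notin> {1, -1}"
      by (rule two_cheb_not_pm1[OF e]) (use that s_e ue' unit_mult_mult in auto)
    then show ?thesis by (simp add: algebra_simps)
  qed
  show ?thesis
  proof (rule chordless_cycle_Irr[where v = v])
    show "3 \<le> 2 * m + 2" using m by simp
  next
    fix t assume t: "Suc t < 2 * m + 2"
    consider "t < m" | "t = m" | "t = m + 1" | "m + 1 < t" "t < 2 * m" | "t = 2 * m" "t > m + 1"
      using t by linarith
    then show "det2 (v t) (v (Suc t)) = 1"
    proof cases
      case 1
      then show ?thesis by (simp add: v_def det2_path_vec)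
    next
      case 2
      then show ?thesis using m by (simp add: v_def w'_def det2_path_vec)
    next
      case 3
      have "odd (m - 1)" "2 * m + 1 - (m + 2) = m - 1" using m by auto
      then show ?thesis using 3 m uu
        by (simp add: v_def w'_def det2_path_vec \<sigma>_def)
    next
      case 4
      then have "2 * m + 1 - t = Suc (2 * m - t)" by simp
      then show ?thesis using 4 ss[of "2 * m - t"]
        by (simp add: v_def det2_path_vec mult.assoc[symmetric])
    next
      case 5
      moreover have "u' * u = 1" using uu by (simp only: mult.commute)
      ultimately show ?thesis using uu by (simp add: v_def w_def det2_path_vec \<sigma>_def)
    qed
  next
    show "det2 (v (2 * m + 2 - 1)) (v 0) = 1"
      using m by (simp add: v_def w_def det2_path_vec)
  next
    fix s t assume st: "s < t" "t < 2 * m + 2" "t \<noteq> Suc s" "\<not> (s = 0 \<and> t = 2 * m + 2 - 1)"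
    \<comment> \<open>On the scaled copy, \<open>i\<close> and \<open>j\<close> are the indices of
      the path vectors at the positions \<open>s\<close> and \<open>t\<close>.\<close>
    define i where "i = 2 * m + 1 - s"
    define j where "j = 2 * m + 1 - t"
    consider "t \<le> m" | "s < m" "t = m + 1" | "s \<le> m" "m + 1 < t" "t \<le> 2 * m"
      | "1 \<le> s" "s \<le> m" "t = 2 * m + 1" | "s = m + 1" "m + 2 < t" "t \<le> 2 * m"
      | "s = m + 1" "t = 2 * m + 1" | "m + 1 < s" "t \<le> 2 * m"
      | "m + 1 < s" "s < 2 * m" "t = 2 * m + 1"
    proof -
      consider "t \<le> m" | "t = m + 1" | "m + 1 < t" "t \<le> 2 * m" "s \<le> m"
        | "m + 1 < t" "t \<le> 2 * m" "s = m + 1" | "m + 1 < s" "t \<le> 2 * m"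
        | "t = 2 * m + 1"
        using st by linarith
      then show thesis
      proof cases
        case 6
        with st consider "1 \<le> s" "s \<le> m" | "s = m + 1" | "m + 1 < s" "s < 2 * m"
          by linarith
        then show thesis using that(4,6,8) 6 by cases
      qed (use that st in auto)
    qed
    then show "det2 (v s) (v t) \<notin> {1, -1}"
    proof cases
      case 1
      then have "det2 (v s) (v t) = 1 * cheb (t - s)"
        using st by (simp add: v_def det2_path_vec)
      then show ?thesis
        using cheb_not_pm1[OF e unit_mult_one, of "t - s"] st by simp
    next
      case 2
      then have "det2 (v s) (v t) = - (1 * cheb (m - 1 - s) + u' * cheb (Suc (m - 1 - s)))"
        using Kaw'[of s] by (simp add: v_def Suc_diff_Suc)
      then show ?thesis by (simp only: neg low1 not_False_eq_True)
    next
      case 3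
      have K: "det2 (v s) (v t) = \<sigma> j * (if s \<le> j then cheb (j - s) else - cheb (s - j))"
        using 3 by (simp add: v_def det2_path_vec j_def)
      \<comment> \<open>Equal indices give parallel vectors and neighbouring ones give
        \<open>\<sigma> j\<close> up to sign, which is where \<open>u\<close> must differ from
        +-1.\<close>
      consider "s = j" | "j = s + 1" | "s = j + 1" | "j \<ge> s + 2" | "s \<ge> j + 2" by linarith
      then show ?thesis
      proof cases
        case 1
        then show ?thesis using K by simp
      next
        case 2
        then show ?thesis using K s_ne[of j] by simp
      next
        case 3
        then show ?thesis using K s_ne[of j] neg[of "\<sigma> j"] by simp
      next
        case 4
        then show ?thesis using K cheb_not_pm1[OF e s_e[of j], of "j - s"] by simp
      next
        case 5
        then have "det2 (v s) (v t) = - (\<sigma> j * cheb (s - j))" using K by simp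
        moreover have "s - j \<ge> 2" using 5 by simp
        ultimately show ?thesis
          by (simp only: neg cheb_not_pm1[OF e s_e] not_False_eq_True)
      qed
    next
      case 4
      then have "v s = path_vec s" "v t = w" "Suc (s - 1) = s"
        by (simp_all add: v_def)
      then have "det2 (v s) (v t) = 1 * cheb (s - 1) + u' * cheb (Suc (s - 1))"
        by (simp only: Kaw[OF 4(1)])
      then show ?thesis by (simp only: low1 not_False_eq_True)
    next
      case 5
      then have "det2 (v s) (v t) = \<sigma> j * (1 * cheb (m - 1 - j) + u' * cheb (Suc (m - 1 - j)))"
        using Kw'a[of j] by (simp add: v_def j_def Suc_diff_Suc)
      moreover have "m - 1 - j \<ge> 1" using 5 by (simp add: j_def)
      ultimately show ?thesis by (simp only: low2 not_False_eq_True)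
    next
      case 6
      have "(1 * cheb (m - 2) + u' * cheb (m - 1) + u' * cheb (m - 1)) + (u' * u') * cheb m \<notin> {1, -1}"
        by (rule low_plus_cheb_not_pm1[OF e unit_mult_mult[OF ue' ue'] _ m(2)],
            intro low_add low_cheb unit_mult_one ue') (use m in linarith)+
      moreover have "det2 (v s) (v t) = det2 w' w"
        using 6 m by (simp add: v_def)
      ultimately show ?thesis by (simp only: Kw'w neg not_False_eq_True)
    next
      case 7
      then have "det2 (v s) (v t) = - ((\<sigma> i * \<sigma> j) * cheb (t - s))"
        using st by (simp add: v_def det2_path_vec i_def j_def)
      moreover have "t - s \<ge> 2" using st by simp
      ultimately show ?thesis
        by (simp only: neg cheb_not_pm1[OF e unit_mult_mult[OF s_e s_e]] not_False_eq_True)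
    next
      case 8
      then have "v s = scale2 (\<sigma> i) (path_vec i)" "v t = w" "Suc (i - 1) = i" "1 \<le> i"
        by (simp_all add: v_def i_def)
      then have "det2 (v s) (v t) = \<sigma> i * (1 * cheb (i - 1) + u' * cheb (Suc (i - 1)))"
        by (simp only: det2_linear Kaw)
      moreover have "i - 1 \<ge> 1" using 8 by (simp add: i_def)
      ultimately show ?thesis by (simp only: low2 not_False_eq_True)
    qed
  qed
qed

text \<open>For \<open>d = 0\<close> the product vanishes, and for \<open>d \<ge> 2\<close> it has
  the coefficient +-f at a positive exponent.\<close>

lemma idempotent_cheb:
  fixes f :: "'a::comm_ring_1"
  assumes mem: "[:f:] * (\<epsilon> * cheb d) \<in> {[:f:], - [:f:]}"
    and eps: "\<epsilon> \<in> {1, -1}" and f: "f \<noteq> 0"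
  shows "d = 1"
proof -
  have "d \<noteq> 0"
  proof
    assume "d = 0"
    then show False using mem f by simp
  qed
  moreover have "\<not> d \<ge> 2"
  proof
    assume d: "d \<ge> 2"
    have top: "coeff (cheb d) (d - 1) = (1 :: 'a)"
      using coeff_cheb_top[of "d - 1"] d by simp
    have "coeff ([:f:] * (\<epsilon> * cheb d)) (d - 1) \<in> {f, - f}"
      using eps top by (elim insertE) simp_all
    moreover have "coeff [:f:] (d - 1) = 0"
      using d by (intro coeff_eq_0) simp
    then have "coeff ([:f:] * (\<epsilon> * cheb d)) (d - 1) = 0"
      using mem by (elim insertE emptyE) (simp_all only: coeff_minus minus_zero)
    ultimately show False using f by simp
  qed
  ultimately show ?thesis by linarith
qed

text \<open>A chord would have determinant +-1 in both components. In one component this happens for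
  nonadjacent times only if they mirror each other up to one step, and the delay of two steps
  prevents it in the other.\<close>

lemma Irr_of_idempotent:
  fixes f :: "'a::comm_ring_1"
  assumes f: "f * f = f" "f \<noteq> 0" "f \<noteq> 1" and m: "even m" "m \<ge> 4"
  shows "\<exists>c \<in> (Irr :: 'a poly list set). length c = 2 * m"
proof -
  define F where "F = [:f:]"
  define G where "G = [:1 - f:]"
  have FG: "F * F = F" "G * G = G" "F * G = 0" "G * F = 0" "F + G = 1"
    using f by (simp_all add: F_def G_def algebra_simps one_pCons)
  \<comment> \<open>\<open>\<alpha>\<close> is the height on the path, \<open>T\<close> runs up and
    back down, and \<open>h\<close> is the delay modulo \<open>2 * m\<close>. Signs alternate on the
    way down because each step there would have determinant -1; they fit at the turning point
    because \<open>m\<close> is even.\<close>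
  define \<alpha> where "\<alpha> t = (if t \<le> m then t else 2 * m - t)" for t
  define T :: "nat \<Rightarrow> 'a poly \<times> 'a poly"
    where "T t = (if t \<le> m then path_vec t else scale2 ((-1) ^ t) (path_vec (2 * m - t)))" for t
  define h where "h t = (if t + 2 < 2 * m then t + 2 else t + 2 - 2 * m)" for t
  define v where "v t = scale2 F (T t) + scale2 G (T (h t))" for t
  have det_v: "det2 (v s) (v t) = F * det2 (T s) (T t) + G * det2 (T (h s)) (T (h t))" for s t
  proof -
    have "det2 (v s) (v t) = (F * F) * det2 (T s) (T t) + (F * G) * det2 (T s) (T (h t))
        + (G * F) * det2 (T (h s)) (T t) + (G * G) * det2 (T (h s)) (T (h t))"
      by (simp add: v_def algebra_simps)
    then show ?thesis by (simp only: FG mult_zero_left add_0_left add_0_right)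
  qed
  have "\<not> 2 * m \<le> m" using m by linarith
  then have "T (2 * m) = scale2 ((-1) ^ (2 * m)) (path_vec 0)"
    by (simp only: T_def if_False diff_self_eq_0)
  then have T_end: "T (2 * m) = T 0" by (simp add: T_def scale2_def)
  have T_step: "det2 (T t) (T (Suc t)) = 1" if "t < 2 * m" for t
  proof -
    consider "t < m" | "t = m" | "m < t" by linarith
    then show ?thesis
    proof cases
      case 1
      then show ?thesis by (simp add: T_def det2_path_vec)
    next
      case 2
      then show ?thesis using m by (simp add: T_def det2_path_vec)
    next
      case 3
      have "(-1 :: 'a poly) ^ t * (-1) ^ Suc t = -1"
        by (cases "even t") simp_all
      moreover have "2 * m - t = Suc (2 * m - Suc t)" using that by simp
      ultimately have "det2 (T t) (T (Suc t)) = ((-1) ^ t * (-1) ^ Suc t) * - cheb (Suc 0)"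
        using 3 by (simp add: T_def det2_path_vec mult.assoc)
      also have "\<dots> = 1"
        by (cases "even t") simp_all
      finally show ?thesis .
    qed
  qed
  \<comment> \<open>The two truncated differences add up to the distance between the
    heights.\<close>
  have T_det: "\<exists>\<epsilon> \<in> {1, -1}. det2 (T s) (T t) = \<epsilon> * cheb ((\<alpha> s - \<alpha> t) + (\<alpha> t - \<alpha> s))" for s t
  proof -
    have sg: "(-1 :: 'a poly) ^ k \<in> {1, -1}" for k
      by (cases "even k") simp_all
    obtain \<epsilon> \<eta> where "T s = scale2 \<epsilon> (path_vec (\<alpha> s))" "T t = scale2 \<eta> (path_vec (\<alpha> t))"
       and e: "\<epsilon> \<in> {1, -1}" "\<eta> \<in> {1, -1}"
    proof -
      have "\<exists>\<epsilon> \<in> {1, -1}. T t = scale2 \<epsilon> (path_vec (\<alpha> t))" for t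
      proof (cases "t \<le> m")
        case True
        then show ?thesis by (auto simp: T_def \<alpha>_def scale2_def)
      next
        case False
        then show ?thesis using sg[of t] by (auto simp: T_def \<alpha>_def)
      qed
      then show ?thesis using that by blast
    qed
    then have "det2 (T s) (T t) = (\<epsilon> * \<eta>) * det2 (path_vec (\<alpha> s)) (path_vec (\<alpha> t))"
      by simp
    also have "\<dots> = (if \<alpha> s \<le> \<alpha> t then \<epsilon> * \<eta> else - (\<epsilon> * \<eta>))
        * cheb ((\<alpha> s - \<alpha> t) + (\<alpha> t - \<alpha> s))"
      by (simp add: det2_path_vec)
    finally show ?thesis by (rule bexI) (use e in auto)
  qed
  have h_step: "det2 (T (h t)) (T (h (Suc t))) = 1" if t: "t < 2 * m" for t
  proof -
    consider "Suc t + 2 < 2 * m" | "Suc t + 2 = 2 * m" | "Suc t + 1 = 2 * m" | "Suc t = 2 * m"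
      using t by linarith
    then show ?thesis
    proof cases
      case 1
      then show ?thesis using T_step[of "t + 2"] by (simp add: h_def)
    next
      case 2
      then have "h t = 2 * m - 1" "h (Suc t) = 0" by (auto simp: h_def)
      then show ?thesis using T_step[of "2 * m - 1"] m T_end by simp
    next
      case 3
      then have "h t = 0" "h (Suc t) = 1" using m by (auto simp: h_def)
      then show ?thesis using T_step[of 0] m by simp
    next
      case 4
      then have "h t = 1" "h (Suc t) = 2" using m by (auto simp: h_def)
      then show ?thesis using T_step[of 1] m by (simp add: numeral_2_eq_2)
    qed
  qed
  show ?thesis
  proof (rule chordless_cycle_Irr[where v = v])
    show "3 \<le> 2 * m" using m by simp
  next
    fix t assume "Suc t < 2 * m"
    then show "det2 (v t) (v (Suc t)) = 1"
      using T_step[of t] h_step[of t] FG by (simp add: det_v)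
  next
    have "h (2 * m) = h 0" using m by (simp add: h_def)
    then show "det2 (v (2 * m - 1)) (v 0) = 1"
      using T_step[of "2 * m - 1"] h_step[of "2 * m - 1"] T_end FG m by (simp add: det_v)
  next
    fix s t assume st: "s < t" "t < 2 * m" "t \<noteq> Suc s" "\<not> (s = 0 \<and> t = 2 * m - 1)"
    show "det2 (v s) (v t) \<notin> {1, -1}"
    proof
      assume pm1: "det2 (v s) (v t) \<in> {1, -1}"
      obtain \<epsilon> where e: "\<epsilon> \<in> {1, -1}"
          "det2 (T s) (T t) = \<epsilon> * cheb ((\<alpha> s - \<alpha> t) + (\<alpha> t - \<alpha> s))"
        using T_det by blast
      obtain \<eta> where n: "\<eta> \<in> {1, -1}" "det2 (T (h s)) (T (h t))
          = \<eta> * cheb ((\<alpha> (h s) - \<alpha> (h t)) + (\<alpha> (h t) - \<alpha> (h s)))"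
        using T_det by blast
      \<comment> \<open>Multiplication by \<open>F\<close> projects to one component and turns +-1
        into +-F.\<close>
      have "F * det2 (v s) (v t) = F * det2 (T s) (T t)"
        unfolding det_v using FG by (simp add: distrib_left mult.assoc[symmetric])
      then have "F * det2 (T s) (T t) \<in> {F, - F}" using pm1 by auto
      then have d1: "(\<alpha> s - \<alpha> t) + (\<alpha> t - \<alpha> s) = 1"
        unfolding F_def e(2) by (rule idempotent_cheb) (use e(1) f(2) in auto)
      have "G * det2 (v s) (v t) = G * det2 (T (h s)) (T (h t))"
        unfolding det_v using FG by (simp add: distrib_left mult.assoc[symmetric])
      then have "G * det2 (T (h s)) (T (h t)) \<in> {G, - G}" using pm1 by auto
      then have d2: "(\<alpha> (h s) - \<alpha> (h t)) + (\<alpha> (h t) - \<alpha> (h s)) = 1"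
        unfolding G_def n(2) by (rule idempotent_cheb) (use n(1) f(3) in auto)
      \<comment> \<open>Heights differing by 1 at nonadjacent times lie on opposite
        branches.\<close>
      have "s \<le> m" "m < t"
        using d1 st unfolding \<alpha>_def by (auto split: if_splits)
      then have sum: "s + t = 2 * m + 1 \<or> s + t + 1 = 2 * m"
        using d1 st unfolding \<alpha>_def by auto
      \<comment> \<open>After the delay the heights differ by at least 3, except in the second case:
        there both times are on the way down and the difference is \<open>t - s\<close>.\<close>
      consider "s + 2 \<le> m" "t + 2 < 2 * m" | "m < s + 2" "t + 2 < 2 * m"
        | "t + 2 = 2 * m" | "t + 1 = 2 * m" using st by linarith
      then show False
      proof cases
        case 1
        then have "\<alpha> (h s) = s + 2" "\<alpha> (h t) = 2 * m - (t + 2)"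
          using \<open>m < t\<close> by (simp_all add: h_def \<alpha>_def)
        then show False using d2 sum 1 by linarith
      next
        case 2
        then have "\<alpha> (h s) = 2 * m - (s + 2)" "\<alpha> (h t) = 2 * m - (t + 2)"
          using \<open>m < t\<close> \<open>s \<le> m\<close> m by (simp_all add: h_def \<alpha>_def)
        then have "t - s = 1" using d2 2 st by linarith
        then show False using st by linarith
      next
        case 3
        then have "s = 1 \<or> s = 3" using sum by linarith
        then have "\<alpha> (h s) \<ge> 3" "\<alpha> (h t) = 0"
          using 3 m by (auto simp: h_def \<alpha>_def)
        then show False using d2 by linarith
      next
        case 4
        then have "s = 2" using sum st by linarith
        then have "\<alpha> (h s) = 4" "\<alpha> (h t) = 1"
          using 4 m by (auto simp: h_def \<alpha>_def)
        then show False using d2 by linarith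
      qed
    qed
  qed
qed

text \<open>The powers are eventually periodic. An exponent that is a multiple of the period
  \<open>p\<close> and not below the preperiod \<open>i\<close>, such as \<open>(i + 1) * p\<close>,
  gives an idempotent.\<close>

lemma finite_ring_idempotent_power:
  fixes a :: "'a::{finite, comm_ring_1}"
  shows "\<exists>m > 0. a ^ m * a ^ m = a ^ m"
proof -
  have "\<not> inj (\<lambda>n :: nat. a ^ n)"
  proof
    assume "inj (\<lambda>n :: nat. a ^ n)"
    moreover have "finite (range (\<lambda>n :: nat. a ^ n))" by simp
    ultimately have "finite (UNIV :: nat set)" by (rule finite_imageD[rotated])
    then show False by simp
  qed
  then obtain k l :: nat where "a ^ k = a ^ l" "k \<noteq> l"
    unfolding inj_def by blast
  then obtain i j where ij: "i < j" "a ^ i = a ^ j"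
    by (cases k l rule: linorder_cases) auto
  define p where "p = j - i"
  have per: "a ^ (s + k * p) = a ^ s" if "i \<le> s" for s k
  proof (induction k)
    case (Suc k)
    have "s + Suc k * p = (s - i + k * p) + j"
      using that ij by (simp add: p_def)
    then have "a ^ (s + Suc k * p) = a ^ (s - i + k * p) * a ^ j"
      by (simp only: power_add)
    also have "\<dots> = a ^ (s - i + k * p + i)"
      by (simp only: power_add ij(2))
    also have "s - i + k * p + i = s + k * p" using that by simp
    finally show ?case using Suc by simp
  qed simp
  have "p > 0" using ij by (simp add: p_def)
  then have "i \<le> (i + 1) * p"
    using mult_le_mono2[of 1 p "i + 1"] by simp
  from per[OF this, of "i + 1"] have "a ^ ((i + 1) * p) * a ^ ((i + 1) * p) = a ^ ((i + 1) * p)"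
    by (simp add: power_add)
  moreover have "(i + 1) * p > 0" using \<open>p > 0\<close> by simp
  ultimately show ?thesis by blast
qed

lemma Irr_poly_unbounded:
  fixes a :: "'a::{finite, comm_ring_1}"
  assumes a: "a \<notin> {0, 1, -1}"
  shows "\<exists>c \<in> (Irr :: 'a poly list set). length c > N"
proof -
  obtain m where m: "m > 0" and idem: "a ^ m * a ^ m = a ^ m"
    using finite_ring_idempotent_power by blast
  \<comment> \<open>Even and at least 4, as the constructions require, and large enough for the
    lengths to exceed \<open>N\<close>.\<close>
  define n where "n = 2 * N + 4"
  have n: "even n" "n \<ge> 4" "n \<ge> 2" "2 * n > N" "2 * n + 2 > N" by (auto simp: n_def)
  consider "a ^ m = 1" | "a ^ m = 0" | "a ^ m \<noteq> 0" "a ^ m \<noteq> 1" by blast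
  then show ?thesis
  proof cases
    case 1
    then have inv: "a * a ^ (m - 1) = 1" "a ^ (m - 1) * a = 1"
      using m by (simp_all add: power_eq_if mult.commute)
    have "\<exists>c \<in> (Irr :: 'a poly list set). length c = 2 * n + 2"
    proof (rule Irr_of_unit[where e = 1 and u = "[:a:]" and u' = "[:a ^ (m - 1):]"])
      show "[:a:] * [:a ^ (m - 1):] = 1" using inv by (simp add: one_pCons)
      show "[:a:] \<notin> {1, -1}" using a by (auto simp: one_pCons)
      show "unit_mult 1 [:a:]" "unit_mult 1 [:a ^ (m - 1):]"
        using inv unfolding unit_mult_def by auto
    qed (use n in auto)
    then show ?thesis using n by metis
  next
    case 2
    \<comment> \<open>The last nonzero power of \<open>a\<close> has square 0, since
      \<open>k \<ge> 2\<close> gives \<open>2 * (k - 1) \<ge> k\<close>.\<close>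
    define k where "k = (LEAST k. a ^ k = 0)"
    have k: "a ^ k = 0" unfolding k_def using 2 by (rule LeastI)
    have "k \<noteq> 0" "k \<noteq> 1" using k a by (metis power_0 zero_neq_one, auto)
    define e where "e = a ^ (k - 1)"
    have e: "e \<noteq> 0"
      unfolding e_def k_def using \<open>k \<noteq> 0\<close> not_less_Least[of "k - 1" "\<lambda>k. a ^ k = 0"]
      by (simp add: k_def)
    have "k - 1 + (k - 1) = k + (k - 2)" using \<open>k \<noteq> 0\<close> \<open>k \<noteq> 1\<close> by simp
    then have ee: "e * e = 0"
      unfolding e_def using k by (metis mult_zero_left power_add)
    have "\<exists>c \<in> (Irr :: 'a poly list set). length c = 2 * n + 2"
    proof (rule Irr_of_unit[where e = e and u = "[:1, e:]" and u' = "[:1, - e:]"])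
      show "[:1, e:] * [:1, - e:] = 1" using ee by (simp add: one_pCons)
      show "[:1, e:] \<notin> {1, -1}" using e by (auto simp: one_pCons)
      show "unit_mult e [:1, e:]" "unit_mult e [:1, - e:]"
        using ee unfolding unit_mult_def by (auto intro!: exI[of _ 1])
    qed (use n e in auto)
    then show ?thesis using n by metis
  next
    case 3
    then show ?thesis using Irr_of_idempotent[OF idem _ _ n(1,2)] n by metis
  qed
qed

section \<open>Classification\<close>

theorem theorem3p6:
  shows "(ell TYPE('a::{finite, comm_ring_1} poly) < \<infinity> \<longleftrightarrow>
            (\<exists>f :: 'a \<Rightarrow> 2. ring_isomorphism f) \<or> (\<exists>f :: 'a \<Rightarrow> 3. ring_isomorphism f))
       \<and> ell TYPE(2 poly) = 4
       \<and> ell TYPE(3 poly) = 4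
       \<and> (Irr :: 2 poly list set) =
            {[1, 1, 1], [-1, -1, -1]}
            \<union> {[0, P, 0, -P] | P. P \<notin> {1, -1}}
            \<union> {[P, 0, -P, 0] | P. P \<notin> {1, -1}}
       \<and> (Irr :: 3 poly list set) =
            {[1, 1, 1], [-1, -1, -1]}
            \<union> {[0, P, 0, -P] | P. P \<notin> {1, -1}}
            \<union> {[P, 0, -P, 0] | P. P \<notin> {1, -1}}"
proof -
  have pm1_2: "\<And>x :: 2. x \<in> {0, 1, -1}" using bit0_num1_cases by blast
  note pm1_3 = bit1_num1_cases
  have "(\<exists>f :: 'a \<Rightarrow> 2. ring_isomorphism f) \<or> (\<exists>f :: 'a \<Rightarrow> 3. ring_isomorphism f)"
    if fin: "ell TYPE('a poly) < \<infinity>"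
  proof -
    obtain N where N: "\<forall>c \<in> (Irr :: 'a poly list set). length c \<le> N"
      using fin unfolding ell_def by (auto split: if_splits)
    have "x \<in> {0, 1, -1}" for x :: 'a
    proof (rule ccontr)
      assume "x \<notin> {0, 1, -1}"
      then obtain c where "c \<in> (Irr :: 'a poly list set)" "length c > N"
        using Irr_poly_unbounded by blast
      with N show False by (meson not_le)
    qed
    then show ?thesis by (rule ring_isomorphism_prime_field)
  qed
  moreover have "ell TYPE('a poly) < \<infinity>"
    if iso: "(\<exists>f :: 'a \<Rightarrow> 2. ring_isomorphism f) \<or> (\<exists>f :: 'a \<Rightarrow> 3. ring_isomorphism f)"
  proof -
    have "x \<in> {0, 1, -1}" for x :: 'a
      using iso ring_isomorphism_pm1[OF _ pm1_2] ring_isomorphism_pm1[OF _ pm1_3] by blast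
    then have "ell TYPE('a poly) = 4" by (rule ell_poly_prime_field)
    then show ?thesis by simp
  qed
  ultimately show ?thesis
    using ell_poly_prime_field[OF pm1_2] ell_poly_prime_field[OF pm1_3]
      Irr_poly_prime_field[OF pm1_2] Irr_poly_prime_field[OF pm1_3]
    by blast
qed

end
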